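(* For each parity $p\in\{\text{odd},\text{even}\}$ and each choice of ratio $r\in\{c_o/c_e,\ c_e/c_o\}$, there exists a sequence $(G_n)$ of $2$-connected outerplanar graphs such that the boundary cycle $\partial G_n$ of the infinite face has length of parity $p$, $|V(G_n)|\to\infty$, and $r(G_n)\to\infty$ as $n\to\infty$.
   Context: All graphs are finite, simple and undirected. For a graph $G$, $c_o(G)$ (resp. $c_e(G)$) denotes the number of distinct cycles of odd (resp. even) length in $G$ (two subgraphs are distinct if their vertex sets or edge sets differ). An outerplanar graph is considered embedded in the plane with all vertices on the boundary of the infinite face; $\partial G$ denotes the boundary walk of the infinite face, which is a cycle when $G$ is $2$-connected. *)

theory Defs
  imports "HOL-Analysis.Analysis"
begin

datatype 'a ugraph = UGraph (verts: "'a set") (edges: "'a set set")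

definition finite_simple_graph :: "'a ugraph \<Rightarrow> bool" where
  "finite_simple_graph G \<longleftrightarrow>
     finite (verts G) \<and> (\<forall>e\<in>edges G. e \<subseteq> verts G \<and> card e = 2)"

definition graph_connected :: "'a ugraph \<Rightarrow> bool" where
  "graph_connected G \<longleftrightarrow> verts G \<noteq> {} \<and>
     (\<forall>u\<in>verts G. \<forall>v\<in>verts G. (u, v) \<in> {(x, y). {x, y} \<in> edges G}\<^sup>*)"

definition delete_verts :: "'a ugraph \<Rightarrow> 'a set \<Rightarrow> 'a ugraph" where
  "delete_verts G S = UGraph (verts G - S) {e \<in> edges G. e \<inter> S = {}}"

definition k_connected :: "nat \<Rightarrow> 'a ugraph \<Rightarrow> bool" where
  "k_connected k G \<longleftrightarrow> card (verts G) > k \<and>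
     (\<forall>S \<subseteq> verts G. card S < k \<longrightarrow> graph_connected (delete_verts G S))"

definition cycle_graph :: "'a list \<Rightarrow> 'a ugraph" where
  "cycle_graph vs =
     UGraph (set vs) {{vs ! i, vs ! (Suc i mod length vs)} | i. i < length vs}"

text \<open>Cycles are subgraphs, so that different cyclic orderings (rotations, reflections) of
  the same cycle are not counted separately.\<close>

definition cycles :: "'a ugraph \<Rightarrow> 'a ugraph set" where
  "cycles G = {cycle_graph vs | vs. length vs \<ge> 3 \<and> distinct vs \<and>
     verts (cycle_graph vs) \<subseteq> verts G \<and> edges (cycle_graph vs) \<subseteq> edges G}"

definition cycle_length :: "'a ugraph \<Rightarrow> nat" where
  "cycle_length C = card (edges C)"

definition c_odd :: "'a ugraph \<Rightarrow> nat" where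
  "c_odd G = card {C \<in> cycles G. odd (cycle_length C)}"

definition c_even :: "'a ugraph \<Rightarrow> nat" where
  "c_even G = card {C \<in> cycles G. even (cycle_length C)}"

definition plane_embedding ::
  "'a ugraph \<Rightarrow> ('a \<Rightarrow> complex) \<Rightarrow> ('a set \<Rightarrow> real \<Rightarrow> complex) \<Rightarrow> bool" where
  "plane_embedding G pos crv \<longleftrightarrow>
     inj_on pos (verts G) \<and>
     (\<forall>e\<in>edges G. arc (crv e) \<and>
        {pathstart (crv e), pathfinish (crv e)} = pos ` e \<and>
        path_image (crv e) \<inter> pos ` verts G = pos ` e) \<and>
     (\<forall>e\<in>edges G. \<forall>f\<in>edges G. e \<noteq> f \<longrightarrow>
        path_image (crv e) \<inter> path_image (crv f) = pos ` (e \<inter> f))"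

definition drawing ::
  "'a ugraph \<Rightarrow> ('a \<Rightarrow> complex) \<Rightarrow> ('a set \<Rightarrow> real \<Rightarrow> complex) \<Rightarrow> complex set" where
  "drawing G pos crv = pos ` verts G \<union> (\<Union>e\<in>edges G. path_image (crv e))"

text \<open>The drawing of a finite graph is compact, so in the plane its \<^const>\<open>outside\<close> is a
  single component of the complement, namely the unbounded one.\<close>

definition infinite_face ::
  "'a ugraph \<Rightarrow> ('a \<Rightarrow> complex) \<Rightarrow> ('a set \<Rightarrow> real \<Rightarrow> complex) \<Rightarrow> complex set" where
  "infinite_face G pos crv = outside (drawing G pos crv)"

definition outerplanar_embedding ::
  "'a ugraph \<Rightarrow> ('a \<Rightarrow> complex) \<Rightarrow> ('a set \<Rightarrow> real \<Rightarrow> complex) \<Rightarrow> bool" where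
  "outerplanar_embedding G pos crv \<longleftrightarrow>
     plane_embedding G pos crv \<and> pos ` verts G \<subseteq> frontier (infinite_face G pos crv)"

text \<open>The boundary of the infinite face as a subgraph. In general the boundary is a closed
  walk; when it is a cycle, the walk is determined by this subgraph.\<close>

definition outer_boundary ::
  "'a ugraph \<Rightarrow> ('a \<Rightarrow> complex) \<Rightarrow> ('a set \<Rightarrow> real \<Rightarrow> complex) \<Rightarrow> 'a ugraph" where
  "outer_boundary G pos crv =
     UGraph {v \<in> verts G. pos v \<in> frontier (infinite_face G pos crv)}
            {e \<in> edges G. path_image (crv e) \<subseteq> frontier (infinite_face G pos crv)}"

end

theory Submission
  imports Defs "HOL-Real_Asymp.Real_Asymp"
begin

text \<open>
  In an outerplanar graph drawn as a polygon with non-crossing chords, a cycle is determined by its vertex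
  set: it visits its vertices in their order around the polygon. The cycles correspond to the subtrees of the
  tree of bounded faces, and the parity of their length is the sum of the parities of the faces enclosed.

  Take a central face of length 4 or 5 with three legs, each a strip of about m quadrangles, two or three
  of them ending in a triangle. The cycles around the central face and around no triangle all have the parity of
  the central face, and there are about m^3 of them. Every other cycle avoids the central face or
  encloses one of the triangles, which leaves only O(m^2) possibilities. So the central face decides which parity
  prevails, and the number of triangles then decides the parity of the boundary.
\<close>

section \<open>Cycles in polygons with non-crossing chords\<close>

definition next_in :: "nat set \<Rightarrow> nat \<Rightarrow> nat \<Rightarrow> bool" where
  "next_in S i j \<longleftrightarrow> i \<in> S \<and> j \<in> S \<and> i < j \<and> (\<forall>k\<in>S. k \<le> i \<or> j \<le> k)"

text \<open>Depends on the set alone, so counting cycles becomes counting sets, with no rotations or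
  reflections to divide out.\<close>

definition polygon :: "nat set \<Rightarrow> nat ugraph" where
  "polygon S = UGraph S (insert {Min S, Max S} {{i, j} | i j. next_in S i j})"

text \<open>The witnesses are the nearest elements of \<open>S\<close> on either side of
  \<open>x\<close>. This turns a skipped vertex into a chord passing over it.\<close>

lemma next_in_gap:
  assumes "finite S" "a \<in> S" "b \<in> S" "a < x" "x < b" "x \<notin> S"
  obtains p q where "next_in S p q" "p < x" "x < q"
proof
  let ?p = "Max {y\<in>S. y < x}" and ?q = "Min {y\<in>S. x < y}"
  have p: "?p \<in> {y\<in>S. y < x}" by (rule Max_in) (use assms in auto)
  have q: "?q \<in> {y\<in>S. x < y}" by (rule Min_in) (use assms in auto)
  have "k \<le> ?p \<or> ?q \<le> k" if "k \<in> S" for k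
  proof (cases "k < x")
    case True
    then show ?thesis using that assms(1) by (auto intro!: Max_ge)
  next
    case False
    with that assms(6) have "x < k" by (metis linorder_neqE_nat)
    then show ?thesis using that assms(1) by (auto intro!: Min_le)
  qed
  then show "next_in S ?p ?q" using p q unfolding next_in_def by auto
  show "?p < x" "x < ?q" using p q by auto
qed

lemma next_in_disjoint:
  assumes "next_in S p q" "next_in S p' q'" "p \<le> p'"
  shows "(p = p' \<and> q = q') \<or> q \<le> p'"
  using assms unfolding next_in_def by (metis leD le_less_linear order.antisym)

lemma next_in_atMost: "next_in {..n} i j \<longleftrightarrow> j = Suc i \<and> i < n"
proof
  assume "next_in {..n} i j"
  then have ij: "i < j" "j \<le> n" "\<forall>k\<in>{..n}. k \<le> i \<or> j \<le> k" unfolding next_in_def by auto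
  then have "Suc i \<le> i \<or> j \<le> Suc i" by (intro ij(3)[rule_format]) auto
  with ij show "j = Suc i \<and> i < n" by auto
qed (auto simp: next_in_def)

lemma Suc_mod_cases: "i < n \<Longrightarrow> Suc i = n \<and> Suc i mod n = 0 \<or> Suc i < n \<and> Suc i mod n = Suc i"
  by (cases "Suc i = n") auto

lemma card_edges_cycle_graph:
  assumes "distinct vs" "3 \<le> length vs"
  shows "card (edges (cycle_graph vs)) = length vs"
proof -
  let ?f = "\<lambda>i. {vs ! i, vs ! (Suc i mod length vs)}"
  have "inj_on ?f {..<length vs}"
  proof (rule inj_onI)
    fix i j assume ij: "i \<in> {..<length vs}" "j \<in> {..<length vs}" "?f i = ?f j"
    have lt: "Suc k mod length vs < length vs" for k using assms by (intro mod_less_divisor) auto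
    \<comment> \<open>Distinct indices with the same edge would each be the cyclic successor of the
      other, which needs length 2.\<close>
    show "i = j"
    proof (rule ccontr)
      assume "i \<noteq> j"
      with ij have "vs ! i = vs ! (Suc j mod length vs)" "vs ! j = vs ! (Suc i mod length vs)"
        using nth_eq_iff_index_eq[OF assms(1)] by (auto simp: doubleton_eq_iff)
      with ij lt have "i = Suc j mod length vs" "j = Suc i mod length vs"
        using nth_eq_iff_index_eq[OF assms(1)] by auto
      with ij assms(2) show False
        using Suc_mod_cases[of i "length vs"] Suc_mod_cases[of j "length vs"] unfolding lessThan_iff by linarith
    qed
  qed
  moreover have "edges (cycle_graph vs) = ?f ` {..<length vs}"
    by (auto simp: cycle_graph_def)
  ultimately show ?thesis by (simp add: card_image)
qed

text \<open>In the sorted list successive entries are neighbours in \<open>S\<close>, and the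
  wrap-around pair consists of the maximum and the minimum.\<close>

lemma polygon_eq_cycle_graph:
  assumes "finite S" "S \<noteq> {}"
  shows "polygon S = cycle_graph (sorted_list_of_set S)"
proof -
  define xs where "xs = sorted_list_of_set S"
  have S: "set xs = S" "length xs = card S" using assms by (auto simp: xs_def)
  have sw: "sorted_wrt (<) xs" by (simp add: xs_def)
  have mono: "xs ! i < xs ! j \<longleftrightarrow> i < j" if "i < length xs" "j < length xs" for i j
    using sorted_wrt_nth_less[OF sw] that by (metis linorder_neqE_nat order.asym less_irrefl)
  have ne: "length xs > 0" using assms S by (simp add: card_gt_0_iff)
  have mle: "xs ! i \<le> xs ! j \<longleftrightarrow> i \<le> j" if "i < length xs" "j < length xs" for i j
    using mono[of j i] that by (simp add: not_less[symmetric])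
  have mem: "x \<in> S \<longleftrightarrow> (\<exists>i<length xs. x = xs ! i)" for x
    unfolding S(1)[symmetric] by (auto simp: in_set_conv_nth)
  have Min: "Min S = xs ! 0"
    by (rule Min_eqI[OF assms(1)]) (use ne mle in \<open>auto simp: mem\<close>)
  have Max: "Max S = xs ! (length xs - 1)"
    by (rule Max_eqI[OF assms(1)]) (use ne mle in \<open>auto simp: mem intro!: exI[of _ "length xs - 1"]\<close>)
  have nx: "next_in S (xs ! i) (xs ! Suc i)" if "Suc i < length xs" for i
    unfolding next_in_def using that mem[of "xs ! i"] mem[of "xs ! Suc i"]
    by (auto simp: mem mono mle dest: Suc_lessD)
  have nxD: "\<exists>i. Suc i < length xs \<and> a = xs ! i \<and> b = xs ! Suc i" if n: "next_in S a b" for a b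
  proof -
    obtain i j where ij: "i < length xs" "j < length xs" "a = xs ! i" "b = xs ! j"
      using n unfolding next_in_def mem by blast
    have "i < j" using n ij mono by (auto simp: next_in_def)
    moreover have "xs ! Suc i \<in> S" using ij \<open>i < j\<close> S(1) by (metis Suc_lessI less_trans nth_mem)
    ultimately have "Suc i \<le> i \<or> j \<le> Suc i" using n ij mle unfolding next_in_def
      by (metis Suc_lessI less_trans)
    with \<open>i < j\<close> have "j = Suc i" by linarith
    with ij show ?thesis by blast
  qed
  have "{{i, j} | i j. next_in S i j} \<union> {{Min S, Max S}} = {{xs ! i, xs ! (Suc i mod length xs)} | i. i < length xs}"
  proof (intro equalityI subsetI)
    fix e assume "e \<in> {{i, j} | i j. next_in S i j} \<union> {{Min S, Max S}}"
    then consider a b where "e = {a,b}" "next_in S a b" | "e = {Min S, Max S}" by blast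
    then show "e \<in> {{xs ! i, xs ! (Suc i mod length xs)} | i. i < length xs}"
    proof cases
      case 1
      then show ?thesis using nxD[OF 1(2)] by fastforce
    next
      case 2
      then show ?thesis using ne Min Max by (auto intro!: exI[of _ "length xs - 1"])
    qed
  next
    fix e assume "e \<in> {{xs ! i, xs ! (Suc i mod length xs)} | i. i < length xs}"
    then obtain i where i: "i < length xs" "e = {xs ! i, xs ! (Suc i mod length xs)}" by blast
    show "e \<in> {{i, j} | i j. next_in S i j} \<union> {{Min S, Max S}}"
    proof (cases "Suc i = length xs")
      case True
      then have "i = length xs - 1" by simp
      then have "e = {Min S, Max S}" using i True Min Max by auto
      then show ?thesis by simp
    next
      case False
      then show ?thesis using i nx[of i] by auto
    qed
  qed
  then show ?thesis unfolding polygon_def cycle_graph_def xs_def[symmetric] S(1) by simp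
qed

lemma card_edges_polygon: "finite S \<Longrightarrow> 3 \<le> card S \<Longrightarrow> card (edges (polygon S)) = card S"
  by (subst polygon_eq_cycle_graph) (auto simp: card_edges_cycle_graph)

text \<open>The labels run round the outer cycle, and \<open>adj\<close> takes the smaller end of an
  edge first. Chords cross exactly when their ends interleave; one inequality excludes this, as the
  two chords may be exchanged.\<close>

locale outer_polygon =
  fixes n :: nat and adj :: "nat \<Rightarrow> nat \<Rightarrow> bool"
  assumes n_ge_2: "2 \<le> n"
    and adj_less: "adj i j \<Longrightarrow> i < j"
    and adj_le: "adj i j \<Longrightarrow> j \<le> n"
    and adj_Suc: "i < n \<Longrightarrow> adj i (Suc i)"
    and adj_ends: "adj 0 n"
    and adj_noncrossing: "adj i j \<Longrightarrow> adj k l \<Longrightarrow> i < k \<Longrightarrow> k < j \<Longrightarrow> l \<le> j"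
begin

definition graph :: "nat ugraph" where
  "graph = UGraph {..n} {{i, j} | i j. adj i j}"

lemma verts_graph [simp]: "verts graph = {..n}"
  by (simp add: graph_def)

lemma edge_iff: "{i, j} \<in> edges graph \<longleftrightarrow> adj i j \<or> adj j i"
  by (auto simp: graph_def doubleton_eq_iff)

lemma edgeE:
  assumes "e \<in> edges graph"
  obtains i j where "e = {i, j}" "adj i j" "i < j" "j \<le> n"
  using assms adj_less adj_le by (auto simp: graph_def)

lemma finite_simple_graph: "finite_simple_graph graph"
  unfolding finite_simple_graph_def
  by (auto elim!: edgeE)

section \<open>2-connectivity from the Hamiltonian outer cycle\<close>

lemma reach_interval:
  assumes "i \<le> j" "j \<le> n" "S \<inter> {i..j} = {}"
  shows "(i, j) \<in> {(x, y). {x, y} \<in> edges (delete_verts graph S)}\<^sup>*"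
  using assms
proof (induction rule: dec_induct)
  case base
  then show ?case by simp
next
  case (step k)
  have "(k, Suc k) \<in> {(x, y). {x, y} \<in> edges (delete_verts graph S)}"
    using step adj_Suc[of k] by (auto simp: delete_verts_def edge_iff)
  moreover have "(i, k) \<in> {(x, y). {x, y} \<in> edges (delete_verts graph S)}\<^sup>*"
    using step by (intro step.IH) auto
  ultimately show ?case by (meson rtrancl.rtrancl_into_rtrancl)
qed

lemma two_connected: "k_connected 2 graph"
  unfolding k_connected_def
proof (intro conjI allI impI)
  show "2 < card (verts graph)" using n_ge_2 by simp
  fix S assume S: "S \<subseteq> verts graph" "card S < 2"
  let ?R = "{(x, y). {x, y} \<in> edges (delete_verts graph S)}"
  have fin: "finite S" using S finite_subset by fastforce
  have uniq: "x = y" if "x \<in> S" "y \<in> S" for x y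
    using S(2) that card_le_Suc0_iff_eq[OF fin] by auto
  have "sym ?R" by (auto simp: sym_def insert_commute)
  then have sym: "(x, y) \<in> ?R\<^sup>* \<Longrightarrow> (y, x) \<in> ?R\<^sup>*" for x y
    by (meson sym_rtrancl symD)
  have main: "(u, v) \<in> ?R\<^sup>*" if uv: "u \<le> v" "v \<le> n" "u \<notin> S" "v \<notin> S" for u v
  proof (cases "S \<inter> {u..v} = {}")
    case True
    then show ?thesis using reach_interval uv by blast
  next
    case False
    then obtain s where s: "s \<in> S" "u \<le> s" "s \<le> v" by auto
    then have s': "u < s" "s < v" "S = {s}" using uv uniq by (auto simp: order_le_less)
    \<comment> \<open>Since \<open>s\<close> blocks the way up, go round the other way: down from
      \<open>u\<close> to 0, over the closing edge to \<open>n\<close>, and down to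
      \<open>v\<close>.\<close>
    have "(0, u) \<in> ?R\<^sup>*" using s' uv by (intro reach_interval) auto
    moreover have "(v, n) \<in> ?R\<^sup>*" using s' uv by (intro reach_interval) auto
    moreover have "(0, n) \<in> ?R" using s' uv adj_ends by (auto simp: delete_verts_def edge_iff)
    ultimately show ?thesis using sym by (meson rtrancl.rtrancl_into_rtrancl rtrancl_trans)
  qed
  have "verts (delete_verts graph S) \<noteq> {}"
  proof
    assume "verts (delete_verts graph S) = {}"
    then have "0 \<in> S" "n \<in> S" by (auto simp: delete_verts_def)
    with uniq n_ge_2 show False by fastforce
  qed
  moreover have "(u, v) \<in> ?R\<^sup>*" if "u \<in> {..n} - S" "v \<in> {..n} - S" for u v
    using main[of u v] main[of v u] sym[of v u] that by (cases "u \<le> v") auto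
  ultimately show "graph_connected (delete_verts graph S)"
    unfolding graph_connected_def by (auto simp: delete_verts_def)
qed

text \<open>If a cycle through the edge between a and b had vertices both between and outside a and b,
  the rest of the cycle would have to cross that edge.\<close>

lemma cycle_edge_in_polygon:
  assumes vs: "distinct vs" "3 \<le> length vs" "edges (cycle_graph vs) \<subseteq> edges graph"
    and e: "e \<in> edges (cycle_graph vs)"
  shows "e \<in> edges (polygon (set vs))"
proof -
  let ?N = "length vs"
  obtain i where i: "i < ?N" "e = {vs ! i, vs ! (Suc i mod ?N)}"
    using e by (auto simp: cycle_graph_def)
  have "e \<in> edges graph" using e vs by auto
  then obtain a b where ab: "e = {a, b}" "adj a b" "a < b" by (rule edgeE)
  \<comment> \<open>The walk round the cycle starting at the second end of \<open>e\<close>: the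
    vertices off \<open>e\<close> are \<open>w 1\<close> to \<open>w (?N - 2)\<close>, and
    \<open>w (?N - 1)\<close> is the first end again.\<close>
  define w where "w k = vs ! ((Suc i + k) mod ?N)" for k
  have wE: "{w k, w (Suc k)} \<in> edges graph" for k
  proof -
    have "(Suc i + k) mod ?N < ?N" using vs by (intro mod_less_divisor) auto
    then have "{w k, w (Suc k)} \<in> edges (cycle_graph vs)"
      unfolding w_def cycle_graph_def by (auto simp: mod_Suc_eq intro!: exI[of _ "(Suc i + k) mod ?N"])
    then show ?thesis using vs by blast
  qed
  have w_surj: "\<exists>k. 1 \<le> k \<and> k \<le> ?N - 2 \<and> x = w k" if x: "x \<in> set vs" "x \<noteq> a" "x \<noteq> b" for x
  proof -
    obtain j where j: "j < ?N" "x = vs ! j" using x by (auto simp: in_set_conv_nth)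
    have ne: "j \<noteq> i" "j \<noteq> Suc i mod ?N" using x i j ab by (auto simp: doubleton_eq_iff)
    show ?thesis
    proof (cases "i < j")
      case True
      with j ne i show ?thesis by (intro exI[of _ "j - Suc i"]) (auto simp: w_def)
    next
      case False
      have "Suc i + (?N + j - Suc i) = ?N + j" using i by simp
      then have "w (?N + j - Suc i) = x" using j unfolding w_def by (metis mod_add_self1 mod_less)
      moreover have "\<not> (Suc i = ?N \<and> j = 0)" using ne by auto
      ultimately show ?thesis using False j ne i by (intro exI[of _ "?N + j - Suc i"]) auto
    qed
  qed
  have w_avoid: "w k \<noteq> a \<and> w k \<noteq> b" if k: "1 \<le> k" "k \<le> ?N - 2" for k
  proof -
    have lt: "(Suc i + k) mod ?N < ?N" "Suc i mod ?N < ?N" using vs by (auto intro!: mod_less_divisor)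
    have "(Suc i + k) mod ?N \<noteq> i"
    proof (cases "Suc i + k < ?N")
      case False
      then have "(Suc i + k) mod ?N = Suc i + k - ?N" using i k by (subst mod_if) auto
      then show ?thesis using k False by auto
    qed (use k in auto)
    moreover have "(Suc i + k) mod ?N \<noteq> Suc i mod ?N"
    proof
      assume "(Suc i + k) mod ?N = Suc i mod ?N"
      then have "?N dvd k" by (metis add_diff_cancel_left' le_add1 mod_eq_dvd_iff_nat)
      with k show False using vs by (auto dest!: dvd_imp_le)
    qed
    ultimately have "w k \<noteq> vs ! i" "w k \<noteq> vs ! (Suc i mod ?N)"
      unfolding w_def using nth_eq_iff_index_eq[OF vs(1)] lt i by auto
    with i ab show ?thesis by (auto simp: doubleton_eq_iff)
  qed
  define inn where "inn x \<longleftrightarrow> a < x \<and> x < b" for x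
  have step: "inn (w k) \<longleftrightarrow> inn (w (Suc k))" if k: "1 \<le> k" "Suc k \<le> ?N - 2" for k
  proof -
    have av: "w k \<noteq> a" "w k \<noteq> b" "w (Suc k) \<noteq> a" "w (Suc k) \<noteq> b" using w_avoid k by auto
    have "adj (w k) (w (Suc k)) \<or> adj (w (Suc k)) (w k)" using wE edge_iff by blast
    \<comment> \<open>An edge sharing no end with the chord from \<open>a\<close> to
      \<open>b\<close> has both ends on the same side of it, by non-crossing.\<close>
    moreover have "inn c \<longleftrightarrow> inn d" if "adj c d" "c \<noteq> a" "d \<noteq> a" "c \<noteq> b" "d \<noteq> b" for c d
      using adj_noncrossing[OF ab(2) that(1)] adj_noncrossing[OF that(1) ab(2)] adj_less[OF that(1)] that ab
      unfolding inn_def by linarith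
    ultimately show ?thesis using av by blast
  qed
  have const: "1 \<le> k \<Longrightarrow> k \<le> ?N - 2 \<Longrightarrow> inn (w k) \<longleftrightarrow> inn (w 1)" for k
  proof (induction k)
    case (Suc k)
    then show ?case using step[of k] by (cases "k = 0") auto
  qed simp
  have abS: "a \<in> set vs" "b \<in> set vs"
  proof -
    have "e \<subseteq> set vs" using i vs by (auto intro!: nth_mem mod_less_divisor)
    with ab show "a \<in> set vs" "b \<in> set vs" by auto
  qed
  \<comment> \<open>All other vertices lie on one side of \<open>e\<close>. If they are inside,
    \<open>a\<close> and \<open>b\<close> are the extremes and \<open>e\<close> is the closing edge;
    otherwise \<open>a\<close> and \<open>b\<close> are neighbours.\<close>
  show ?thesis
  proof (cases "inn (w 1)")
    case True
    then have all: "a \<le> x \<and> x \<le> b" if "x \<in> set vs" for x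
      using w_surj[OF that] const unfolding inn_def by (metis less_imp_le order_refl ab(3))
    have "Min (set vs) = a" "Max (set vs) = b"
      using all abS by (auto intro!: Min_eqI Max_eqI)
    then show ?thesis by (simp add: polygon_def ab)
  next
    case False
    then have "\<not> inn x" if "x \<in> set vs" for x
      using w_surj[OF that] const unfolding inn_def by (metis less_irrefl)
    then have "next_in (set vs) a b" using abS ab unfolding inn_def next_in_def by force
    then show ?thesis by (auto simp: polygon_def ab)
  qed
qed

section \<open>Cycles as vertex sets\<close>

definition cycle_verts :: "nat set set" where
  "cycle_verts = {S. S \<subseteq> {..n} \<and> 3 \<le> card S \<and> adj (Min S) (Max S) \<and> (\<forall>i j. next_in S i j \<longrightarrow> adj i j)}"

lemma polygon_in_cycles:
  assumes "S \<in> cycle_verts"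
  shows "polygon S \<in> cycles graph"
proof -
  have S: "S \<subseteq> {..n}" "3 \<le> card S" "adj (Min S) (Max S)" "\<And>i j. next_in S i j \<Longrightarrow> adj i j"
    using assms by (auto simp: cycle_verts_def)
  have fin: "finite S" using S finite_subset by blast
  have p: "polygon S = cycle_graph (sorted_list_of_set S)"
    using fin S by (intro polygon_eq_cycle_graph) auto
  have "verts (polygon S) \<subseteq> verts graph" "edges (polygon S) \<subseteq> edges graph"
    using S by (auto simp: polygon_def edge_iff)
  then show ?thesis unfolding cycles_def using S fin p
    by (auto intro!: exI[of _ "sorted_list_of_set S"])
qed

text \<open>\<open>cycle_edge_in_polygon\<close> gives one inclusion of edge sets; equality follows
  because both have as many edges as the cycle has vertices.\<close>

lemma cycle_is_polygon:
  assumes "C \<in> cycles graph"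
  obtains S where "S \<in> cycle_verts" "C = polygon S"
proof -
  obtain vs where vs: "C = cycle_graph vs" "3 \<le> length vs" "distinct vs"
    "verts (cycle_graph vs) \<subseteq> verts graph" "edges (cycle_graph vs) \<subseteq> edges graph"
    using assms by (auto simp: cycles_def)
  have card: "card (set vs) = length vs" using vs distinct_card by blast
  have sub: "edges C \<subseteq> edges (polygon (set vs))"
    using cycle_edge_in_polygon vs by blast
  \<comment> \<open>An infinite set has \<open>card\<close> 0, so a cardinality of at least 3 yields
    finiteness.\<close>
  have "finite (edges (polygon (set vs)))"
    using card_edges_polygon[of "set vs"] card vs by (metis List.finite_set card.infinite not_numeral_le_zero)
  then have "edges C = edges (polygon (set vs))"
    using sub card_edges_polygon[of "set vs"] card_edges_cycle_graph[of vs] vs card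
    by (intro card_subset_eq) auto
  moreover have "verts C = verts (polygon (set vs))" by (simp add: vs polygon_def cycle_graph_def)
  ultimately have C: "C = polygon (set vs)" by (simp add: ugraph.expand)
  have E: "edges (polygon (set vs)) \<subseteq> edges graph" using vs C by auto
  have "set vs \<in> cycle_verts"
    unfolding cycle_verts_def
  proof (intro CollectI conjI allI impI)
    show "set vs \<subseteq> {..n}" using vs by (simp add: cycle_graph_def)
    show "3 \<le> card (set vs)" using vs card by simp
    have "Min (set vs) \<le> Max (set vs)" using vs(2) by (intro Min.coboundedI Max_in) auto
    moreover have "{Min (set vs), Max (set vs)} \<in> edges graph" using E by (auto simp: polygon_def)
    ultimately show "adj (Min (set vs)) (Max (set vs))" using adj_less by (auto simp: edge_iff dest!: adj_less)
    fix i j assume ij: "next_in (set vs) i j"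
    then have "{i, j} \<in> edges graph" using E by (auto simp: polygon_def)
    then show "adj i j" using ij adj_less[of j i] by (auto simp: edge_iff next_in_def)
  qed
  with C show ?thesis using that by blast
qed

text \<open>\<open>polygon\<close> is a bijection from \<open>cycle_verts\<close> to the cycles, and
  it turns cardinality into length.\<close>

lemma card_cycles_parity:
  "card {C \<in> cycles graph. Q (cycle_length C)} = card {S \<in> cycle_verts. Q (card S)}"
proof -
  have len: "cycle_length (polygon S) = card S" if "S \<in> cycle_verts" for S
    using that finite_subset[of S "{..n}"] unfolding cycle_length_def
    by (intro card_edges_polygon) (auto simp: cycle_verts_def)
  have "inj_on polygon {S \<in> cycle_verts. Q (card S)}"
    by (auto simp: inj_on_def polygon_def)
  moreover have "polygon ` {S \<in> cycle_verts. Q (card S)} = {C \<in> cycles graph. Q (cycle_length C)}"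
    using len polygon_in_cycles by (auto elim!: cycle_is_polygon)
  ultimately show ?thesis by (metis card_image)
qed

end

section \<open>Drawing on a parabola\<close>

text \<open>With vertices on a parabola, the point k has height (k - i)(k - j) over the line through
  the points i and j, so its sign tells on which side of a chord a vertex lies.\<close>

definition parabola :: "nat \<Rightarrow> complex" where
  "parabola k = Complex (real k) ((real k)\<^sup>2)"

definition height :: "nat \<Rightarrow> nat \<Rightarrow> complex \<Rightarrow> real" where
  "height i j z = Im z - (real i + real j) * Re z + real i * real j"

text \<open>Edges are unordered, so \<open>Min\<close> and \<open>Max\<close> supply an
  orientation.\<close>

definition segment_path :: "nat set \<Rightarrow> real \<Rightarrow> complex" where
  "segment_path e = linepath (parabola (Min e)) (parabola (Max e))"

lemma parabola_sel [simp]: "Re (parabola k) = real k" "Im (parabola k) = (real k)\<^sup>2"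
  by (simp_all add: parabola_def)

lemma parabola_eq_iff [simp]: "parabola i = parabola j \<longleftrightarrow> i = j"
  by (auto simp: complex_eq_iff)

lemma height_parabola: "height i j (parabola k) = (real k - real i) * (real k - real j)"
  by (simp add: height_def algebra_simps power2_eq_square)

lemma height_affine:
  "height i j ((1 - t) *\<^sub>R x + t *\<^sub>R y) = (1 - t) * height i j x + t * height i j y"
  by (simp add: height_def algebra_simps)

text \<open>The line through the two points is not vertical, so the real part parametrizes it.
  Membership thus becomes one equation and two inequalities.\<close>

lemma segment_parabola_iff:
  assumes "i < j"
  shows "z \<in> closed_segment (parabola i) (parabola j) \<longleftrightarrow> height i j z = 0 \<and> real i \<le> Re z \<and> Re z \<le> real j"
proof
  assume "z \<in> closed_segment (parabola i) (parabola j)"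
  then obtain t where t: "0 \<le> t" "t \<le> 1" "z = (1 - t) *\<^sub>R parabola i + t *\<^sub>R parabola j"
    by (auto simp: closed_segment_def)
  have "Re z = real i + t * (real j - real i)" unfolding t(3) by (simp add: algebra_simps)
  moreover have "0 \<le> t * (real j - real i)" "t * (real j - real i) \<le> 1 * (real j - real i)"
    using t assms by (auto intro!: mult_nonneg_nonneg mult_right_mono)
  ultimately show "height i j z = 0 \<and> real i \<le> Re z \<and> Re z \<le> real j"
    using t by (simp add: height_affine height_parabola)
next
  assume z: "height i j z = 0 \<and> real i \<le> Re z \<and> Re z \<le> real j"
  define t where "t = (Re z - real i) / (real j - real i)"
  have t: "0 \<le> t" "t \<le> 1" "t * (real j - real i) = Re z - real i"
    using z assms by (auto simp: t_def field_simps)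
  have "Re z = (1 - t) * real i + t * real j" using t(3) by (simp add: algebra_simps)
  moreover have "Im z = (1 - t) * (real i)\<^sup>2 + t * (real j)\<^sup>2"
  proof -
    have "Im z = (real i)\<^sup>2 + (real i + real j) * (Re z - real i)"
      using z by (simp add: height_def algebra_simps power2_eq_square)
    also have "\<dots> = (real i)\<^sup>2 + (real i + real j) * (t * (real j - real i))" by (simp only: t(3))
    also have "\<dots> = (1 - t) * (real i)\<^sup>2 + t * (real j)\<^sup>2" by (simp add: algebra_simps power2_eq_square)
    finally show ?thesis .
  qed
  ultimately have "z = (1 - t) *\<^sub>R parabola i + t *\<^sub>R parabola j" by (simp add: complex_eq_iff)
  with t show "z \<in> closed_segment (parabola i) (parabola j)" by (auto simp: closed_segment_def)
qed

text \<open>By convexity of the parabola the inner chord lies on or below the outer one, with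
  contact only at a shared end.\<close>

lemma nested_segments:
  assumes "i \<le> k" "k < l" "l \<le> j" "(i, j) \<noteq> (k, l)"
    and z: "z \<in> closed_segment (parabola i) (parabola j)" "z \<in> closed_segment (parabola k) (parabola l)"
  shows "z \<in> parabola ` ({i, j} \<inter> {k, l})"
proof -
  have h: "height i j z = 0" "height k l z = 0" "real k \<le> Re z" "Re z \<le> real l"
    using z assms by (auto simp: segment_parabola_iff)
  let ?x = "Re z"
  \<comment> \<open>The difference of the two heights is affine in \<open>Re z\<close>. This is its
    linear interpolation between the points \<open>k\<close> and \<open>l\<close>, where its values
    are nonnegative; as it vanishes at \<open>z\<close>, both terms vanish.\<close>
  have "(real l - ?x) * ((real k - real i) * (real j - real k)) + (?x - real k) * ((real l - real i) * (real j - real l))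
     = (real l - real k) * (height k l z - height i j z)"
    by (simp add: height_def algebra_simps)
  also have "\<dots> = 0" using h by simp
  finally have sum0: "(real l - ?x) * ((real k - real i) * (real j - real k)) + (?x - real k) * ((real l - real i) * (real j - real l)) = 0" .
  have nn: "0 \<le> (real l - ?x) * ((real k - real i) * (real j - real k))"
    "0 \<le> (?x - real k) * ((real l - real i) * (real j - real l))"
    using h assms by (auto intro!: mult_nonneg_nonneg)
  then have "(real l - ?x) * ((real k - real i) * (real j - real k)) = 0"
    "(?x - real k) * ((real l - real i) * (real j - real l)) = 0" using sum0 by linarith+
  then have "(?x = real l \<or> k = i) \<and> (?x = real k \<or> l = j)"
    using assms by auto
  with assms(2,4) have "(?x = real l \<and> l = j) \<or> (?x = real k \<and> k = i)" by auto
  moreover have "z = parabola l" if "?x = real l" using h that by (auto simp: height_def complex_eq_iff algebra_simps power2_eq_square)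
  moreover have "z = parabola k" if "?x = real k" using h that by (auto simp: height_def complex_eq_iff algebra_simps power2_eq_square)
  ultimately show ?thesis by auto
qed

lemma path_image_segment_path: "i < j \<Longrightarrow> path_image (segment_path {i, j}) = closed_segment (parabola i) (parabola j)"
  by (simp add: segment_path_def max_def)

lemma vertex_on_segment:
  assumes "i < j" "parabola k \<in> closed_segment (parabola i) (parabola j)"
  shows "k = i \<or> k = j"
  using assms by (auto simp: segment_parabola_iff height_parabola)

lemma continuous_height [continuous_intros]: "continuous_on A (height i j)"
  unfolding height_def by (intro continuous_intros)

section \<open>The drawing and its infinite face\<close>

context outer_polygon
begin

text \<open>Non-crossing chords lie side by side or nested. Side by side, the real part alone forces
  a common point to be a shared end.\<close>

lemma segments_meet:
  assumes "adj i j" "adj k l" "(i, j) \<noteq> (k, l)"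
    and z: "z \<in> closed_segment (parabola i) (parabola j)" "z \<in> closed_segment (parabola k) (parabola l)"
  shows "z \<in> parabola ` ({i, j} \<inter> {k, l})"
proof -
  have lt: "i < j" "k < l" using assms adj_less by auto
  have nc: "i < k \<Longrightarrow> k < j \<Longrightarrow> l \<le> j" "k < i \<Longrightarrow> i < l \<Longrightarrow> j \<le> l"
    using adj_noncrossing assms by blast+
  have touch: "z \<in> parabola ` ({i, j} \<inter> {k, l})"
    if "i < j" "k < l" "j \<le> k" "z \<in> closed_segment (parabola i) (parabola j)" "z \<in> closed_segment (parabola k) (parabola l)" for i j k l
  proof -
    have "Re z \<le> real j" "real k \<le> Re z" "height i j z = 0" using that by (auto simp: segment_parabola_iff)
    then have "Re z = real j" "j = k" using that by auto
    with \<open>height i j z = 0\<close> have "z = parabola j" by (auto simp: height_def complex_eq_iff algebra_simps power2_eq_square)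
    with \<open>j = k\<close> show ?thesis by auto
  qed
  consider "j \<le> k" | "l \<le> i" | "i \<le> k" "l \<le> j" | "k \<le> i" "j \<le> l" using lt nc by linarith
  then show ?thesis
  proof cases
    case 1 then show ?thesis using touch lt z by blast
  next
    case 2 then show ?thesis using touch[of k l i j] lt z by blast
  next
    case 3 then show ?thesis using nested_segments lt z assms(3) by blast
  next
    case 4 then show ?thesis using nested_segments[of k i j l z] lt z assms(3) by auto
  qed
qed

lemma plane_embedding: "plane_embedding graph parabola segment_path"
  unfolding plane_embedding_def
proof (intro conjI ballI impI)
  show "inj_on parabola (verts graph)" by (auto simp: inj_on_def)
next
  fix e assume "e \<in> edges graph"
  then obtain i j where e: "e = {i, j}" "adj i j" "i < j" "j \<le> n" by (rule edgeE)
  show "arc (segment_path e)" using e by (auto simp: segment_path_def max_def intro!: arc_linepath)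
  show "{pathstart (segment_path e), pathfinish (segment_path e)} = parabola ` e" using e by (simp add: segment_path_def max_def)
  show "path_image (segment_path e) \<inter> parabola ` verts graph = parabola ` e"
    using e vertex_on_segment[OF e(3)] by (auto simp: path_image_segment_path)
next
  fix e f assume ef: "e \<in> edges graph" "f \<in> edges graph" "e \<noteq> f"
  obtain i j where e: "e = {i, j}" "adj i j" "i < j" "j \<le> n" using ef by (blast elim: edgeE)
  obtain k l where f: "f = {k, l}" "adj k l" "k < l" "l \<le> n" using ef by (blast elim: edgeE)
  have "(i, j) \<noteq> (k, l)" using ef e f by auto
  then show "path_image (segment_path e) \<inter> path_image (segment_path f) = parabola ` (e \<inter> f)"
    using segments_meet[OF e(2) f(2)] e f by (auto simp: path_image_segment_path)
qed

text \<open>The convex hull of the points 0, ..., n, given by its supporting half-planes.\<close>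

definition region :: "complex set" where
  "region = {z. (\<forall>k<n. 0 \<le> height k (Suc k) z) \<and> height 0 n z \<le> 0}"

definition rim :: "complex set" where
  "rim = (\<Union>k<n. closed_segment (parabola k) (parabola (Suc k))) \<union> closed_segment (parabola 0) (parabola n)"

lemma closed_region: "closed region"
proof -
  have "region = (\<Inter>k<n. {z. 0 \<le> height k (Suc k) z}) \<inter> {z. height 0 n z \<le> 0}"
    by (auto simp: region_def)
  then show ?thesis by (auto intro!: closed_INT closed_Int closed_Collect_le continuous_intros)
qed

lemma convex_region: "convex region"
  unfolding convex_alt region_def
  by (auto simp: height_affine intro!: add_nonneg_nonneg add_nonpos_nonpos mult_nonneg_nonneg mult_nonneg_nonpos)

lemma parabola_in_region: "k \<le> n \<Longrightarrow> parabola k \<in> region"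
proof -
  assume k: "k \<le> n"
  \<comment> \<open>No integer lies strictly between \<open>i\<close> and \<open>Suc i\<close>, so
    the two factors never have opposite signs.\<close>
  have "0 \<le> (real k - real i) * (real k - real (Suc i))" for i
    by (cases "k \<le> i") (auto intro: mult_nonneg_nonneg mult_nonpos_nonpos)
  moreover have "(real k - real 0) * (real k - real n) \<le> 0" using k by (intro mult_nonneg_nonpos) auto
  ultimately show ?thesis by (simp add: region_def height_parabola)
qed

lemma segment_in_region: "i \<le> n \<Longrightarrow> j \<le> n \<Longrightarrow> closed_segment (parabola i) (parabola j) \<subseteq> region"
  using convex_region parabola_in_region closed_segment_subset by blast

text \<open>The vertical bounds come from comparing the closing chord with the first and with the
  last side; \<open>n_ge_2\<close> makes the factor \<open>real n - 1\<close> positive.\<close>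

lemma region_Re:
  assumes "z \<in> region"
  shows "0 \<le> Re z" "Re z \<le> real n"
proof -
  have h: "0 \<le> height 0 (Suc 0) z" "0 \<le> height (n - 1) (Suc (n - 1)) z" "height 0 n z \<le> 0"
    using assms n_ge_2 unfolding region_def mem_Collect_eq by (metis One_nat_def diff_less less_le_trans pos2 zero_less_one)+
  have "(real n - 1) * Re z \<ge> 0" using h(1,3) by (simp add: height_def algebra_simps)
  then show "0 \<le> Re z" using n_ge_2 by (simp add: zero_le_mult_iff)
  have "(real n - 1) * (real n - Re z) \<ge> 0" using h(2,3) n_ge_2 by (simp add: height_def algebra_simps of_nat_diff)
  then show "Re z \<le> real n" using n_ge_2 by (simp add: zero_le_mult_iff)
qed

lemma bounded_region: "bounded region"
proof (rule boundedI)
  fix z assume z: "z \<in> region"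
  have "0 \<le> height 0 (Suc 0) z" "height 0 n z \<le> 0" using z n_ge_2 by (auto simp: region_def)
  then have "0 \<le> Im z" "Im z \<le> real n * Re z" using region_Re[OF z] by (auto simp: height_def)
  moreover have "real n * Re z \<le> real n * real n" using region_Re[OF z] by (intro mult_left_mono) auto
  ultimately have "\<bar>Re z\<bar> + \<bar>Im z\<bar> \<le> real n + real n * real n" using region_Re[OF z] by auto
  then show "norm z \<le> real n + real n * real n" using cmod_le order_trans by blast
qed

lemma frontier_region: "frontier region = rim"
proof (intro equalityI subsetI)
  fix z assume z: "z \<in> frontier region"
  then have zr: "z \<in> region" using closed_region frontier_subset_closed by blast
  \<comment> \<open>Strict inequalities give an open subset of the region, so a frontier point
    satisfies one of the constraints with equality.\<close>
  let ?O = "(\<Inter>k<n. {z. 0 < height k (Suc k) z}) \<inter> {z. height 0 n z < 0}"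
  have "open ?O" by (auto intro!: open_INT open_Int open_Collect_less continuous_intros)
  moreover have "?O \<subseteq> region" by (auto simp: region_def intro: less_imp_le)
  ultimately have "?O \<subseteq> interior region" by (intro interior_maximal)
  then have "z \<notin> ?O" using z by (auto simp: frontier_def)
  then consider k where "k < n" "height k (Suc k) z \<le> 0" | "0 \<le> height 0 n z" by fastforce
  then show "z \<in> rim"
  proof cases
    case 1
    then have h: "height k (Suc k) z = 0" using zr by (auto simp: region_def intro: antisym)
    \<comment> \<open>The constraint of the preceding side confines the point to the part of the
      line right of \<open>k\<close>; the following side bounds it likewise from the right.\<close>
    have "real k \<le> Re z"
    proof (cases k)
      case 0 then show ?thesis using region_Re zr by simp
    next
      case (Suc l)
      then have "0 \<le> height l (Suc l) z" using zr 1 by (auto simp: region_def)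
      then show ?thesis using h Suc by (simp add: height_def algebra_simps)
    qed
    moreover have "Re z \<le> real (Suc k)"
    proof (cases "Suc k = n")
      case True then show ?thesis using region_Re zr by simp
    next
      case False
      then have "0 \<le> height (Suc k) (Suc (Suc k)) z" using zr 1 by (auto simp: region_def)
      then show ?thesis using h by (simp add: height_def algebra_simps)
    qed
    ultimately have "z \<in> closed_segment (parabola k) (parabola (Suc k))"
      using h by (simp add: segment_parabola_iff)
    then show ?thesis using 1 by (auto simp: rim_def)
  next
    case 2
    then have "height 0 n z = 0" using zr by (auto simp: region_def)
    then have "z \<in> closed_segment (parabola 0) (parabola n)"
      using region_Re zr n_ge_2 by (simp add: segment_parabola_iff)
    then show ?thesis by (auto simp: rim_def)
  qed
next
  fix z assume z: "z \<in> rim"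
  have "closed_segment (parabola k) (parabola (Suc k)) \<subseteq> region" if "k < n" for k
    using that by (intro segment_in_region) auto
  moreover have "closed_segment (parabola 0) (parabola n) \<subseteq> region" by (intro segment_in_region) auto
  ultimately have zr: "z \<in> region" using z unfolding rim_def by blast
  have "z \<notin> interior region"
  proof
    assume "z \<in> interior region"
    then obtain d where d: "d > 0" "cball z d \<subseteq> region" by (auto simp: mem_interior_cball)
    \<comment> \<open>A vertical shift leaves the region: downwards from a short side, upwards from
      the closing chord.\<close>
    have "z + Complex 0 d \<in> cball z d" "z - Complex 0 d \<in> cball z d"
      using d by (auto simp: dist_norm complex_norm)
    then have r: "z + Complex 0 d \<in> region" "z - Complex 0 d \<in> region" using d by auto
    from z consider k where "k < n" "z \<in> closed_segment (parabola k) (parabola (Suc k))" | "z \<in> closed_segment (parabola 0) (parabola n)"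
      by (auto simp: rim_def)
    then show False
    proof cases
      case 1
      then have "height k (Suc k) z = 0" by (simp add: segment_parabola_iff)
      moreover have "0 \<le> height k (Suc k) (z - Complex 0 d)" using r 1 by (auto simp: region_def)
      ultimately show False using d by (simp add: height_def)
    next
      case 2
      then have "height 0 n z = 0" using n_ge_2 by (simp add: segment_parabola_iff)
      moreover have "height 0 n (z + Complex 0 d) \<le> 0" using r by (auto simp: region_def)
      ultimately show False using d by (simp add: height_def)
    qed
  qed
  with zr show "z \<in> frontier region" by (simp add: frontier_def closed_region closure_closed)
qed

text \<open>The drawing lies between \<open>rim\<close> and the convex region that
  \<open>rim\<close> bounds, so its outside is exactly the complement of that region.\<close>

lemma frontier_infinite_face: "frontier (infinite_face graph parabola segment_path) = rim"
proof -
  let ?D = "drawing graph parabola segment_path"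
  have "?D \<subseteq> region"
  proof
    fix z assume "z \<in> ?D"
    then consider k where "k \<le> n" "z = parabola k" | e where "e \<in> edges graph" "z \<in> path_image (segment_path e)"
      by (auto simp: drawing_def)
    then show "z \<in> region"
    proof cases
      case 1 then show ?thesis using parabola_in_region by simp
    next
      case 2
      obtain i j where "e = {i, j}" "i < j" "j \<le> n" using 2(1) by (rule edgeE)
      then show ?thesis using 2(2) segment_in_region[of i j] by (auto simp: path_image_segment_path)
    qed
  qed
  then have 1: "- region \<subseteq> outside ?D"
    using outside_mono outside_convex[OF convex_region] by metis
  have "closed_segment (parabola k) (parabola (Suc k)) \<subseteq> ?D" if "k < n" for k
    using adj_Suc[OF that] edge_iff[of k "Suc k"] path_image_segment_path[of k "Suc k"] unfolding drawing_def by fastforce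
  moreover have "closed_segment (parabola 0) (parabola n) \<subseteq> ?D"
    using adj_ends edge_iff[of 0 n] path_image_segment_path[of 0 n] n_ge_2 unfolding drawing_def by fastforce
  ultimately have "frontier region \<subseteq> ?D" unfolding frontier_region rim_def by blast
  then have "outside ?D \<subseteq> outside (frontier region)" by (rule outside_mono)
  also have "\<dots> \<subseteq> - region"
    using outside_frontier_misses_closure[OF bounded_region] closed_region by (simp add: closure_closed)
  finally have "outside ?D = - region" using 1 by blast
  then show ?thesis by (simp add: infinite_face_def frontier_region)
qed

lemma parabola_in_rim: "k \<le> n \<Longrightarrow> parabola k \<in> rim"
  by (cases "k = n") (auto simp: rim_def intro!: bexI[of _ k])

lemma outerplanar: "outerplanar_embedding graph parabola segment_path"
  using plane_embedding parabola_in_rim by (auto simp: outerplanar_embedding_def frontier_infinite_face)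

text \<open>The midpoint of an edge is not an end, so by \<open>segments_meet\<close> it lies on no
  other edge. If it is on the rim, the edge itself is a rim side.\<close>

lemma segment_in_rim_iff:
  assumes "adj i j"
  shows "closed_segment (parabola i) (parabola j) \<subseteq> rim \<longleftrightarrow> j = Suc i \<or> (i = 0 \<and> j = n)"
proof
  assume sub: "closed_segment (parabola i) (parabola j) \<subseteq> rim"
  have ij: "i < j" "j \<le> n" using assms adj_less adj_le by auto
  let ?m = "midpoint (parabola i) (parabola j)"
  have m: "?m \<in> closed_segment (parabola i) (parabola j)" by simp
  have ne: "?m \<notin> parabola ` {i, j}" using ij by (auto simp: midpoint_eq_endpoint)
  have "?m \<in> rim" using m sub by blast
  then consider k where "k < n" "?m \<in> closed_segment (parabola k) (parabola (Suc k))" | "?m \<in> closed_segment (parabola 0) (parabola n)"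
    unfolding rim_def by blast
  then show "j = Suc i \<or> (i = 0 \<and> j = n)"
  proof cases
    case 1
    then show ?thesis using segments_meet[OF assms adj_Suc _ m] ne by blast
  next
    case 2
    then show ?thesis using segments_meet[OF assms adj_ends _ m] ne by blast
  qed
next
  assume "j = Suc i \<or> (i = 0 \<and> j = n)"
  then show "closed_segment (parabola i) (parabola j) \<subseteq> rim"
    using adj_le[OF assms] less_eq_Suc_le[of i n] unfolding rim_def by blast
qed

lemma outer_boundary: "outer_boundary graph parabola segment_path = polygon {..n}"
proof -
  have "{e \<in> edges graph. path_image (segment_path e) \<subseteq> rim} = insert {0, n} {{i, j} | i j. next_in {..n} i j}"
  proof (intro equalityI subsetI)
    fix e assume e: "e \<in> {e \<in> edges graph. path_image (segment_path e) \<subseteq> rim}"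
    then obtain i j where ij: "e = {i, j}" "adj i j" "i < j" "j \<le> n" by (blast elim: edgeE)
    then show "e \<in> insert {0, n} {{i, j} | i j. next_in {..n} i j}"
      using e segment_in_rim_iff[OF ij(2)] by (auto simp: path_image_segment_path next_in_atMost)
  next
    fix e assume "e \<in> insert {0, n} {{i, j} | i j. next_in {..n} i j}"
    then obtain i j where ij: "e = {i, j}" "j = Suc i \<and> i < n \<or> i = 0 \<and> j = n" 
      by (auto simp: next_in_atMost)
    then have "adj i j" using adj_Suc adj_ends by auto
    then show "e \<in> {e \<in> edges graph. path_image (segment_path e) \<subseteq> rim}"
      using ij segment_in_rim_iff[of i j] adj_less[of i j] by (auto simp: edge_iff path_image_segment_path)
  qed
  moreover have "{v \<in> verts graph. parabola v \<in> rim} = {..n}" using parabola_in_rim by auto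
  moreover have "Min {..n} = 0" "Max {..n} = n" by (auto intro!: Min_eqI Max_eqI)
  ultimately show ?thesis unfolding outer_boundary_def polygon_def frontier_infinite_face by simp
qed

lemma outer_boundary_cycle:
  "outer_boundary graph parabola segment_path \<in> cycles graph"
  "cycle_length (outer_boundary graph parabola segment_path) = Suc n"
proof -
  have "Min {..n} = 0" "Max {..n} = n" by (auto intro!: Min_eqI Max_eqI)
  then have "{..n} \<in> cycle_verts"
    using n_ge_2 adj_Suc adj_ends by (auto simp: cycle_verts_def next_in_atMost)
  then show "outer_boundary graph parabola segment_path \<in> cycles graph"
    unfolding outer_boundary by (rule polygon_in_cycles)
  show "cycle_length (outer_boundary graph parabola segment_path) = Suc n"
    unfolding outer_boundary cycle_length_def using n_ge_2 by (subst card_edges_polygon) auto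
qed

end

section \<open>Counting cycles of legs\<close>

text \<open>A list of lengths cuts an interval starting at a into consecutive legs; each leg is a path whose
  vertices are also joined to their mirror images.\<close>

fun chord :: "nat list \<Rightarrow> nat \<Rightarrow> nat \<Rightarrow> nat \<Rightarrow> bool" where
  "chord [] a i j \<longleftrightarrow> False"
| "chord (L # ls) a i j \<longleftrightarrow>
     a \<le> i \<and> i < j \<and> j \<le> a + L \<and> (j = Suc i \<or> i + j = 2 * a + L) \<or> chord ls (a + L) i j"

text \<open>Increasing paths from one end to the other, represented by their vertex sets.\<close>

definition walks :: "nat list \<Rightarrow> nat \<Rightarrow> nat set set" where
  "walks ls a = {S. S \<subseteq> {a..a + sum_list ls} \<and> a \<in> S \<and> a + sum_list ls \<in> S \<and>
     (\<forall>i j. next_in S i j \<longrightarrow> chord ls a i j)}"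

text \<open>The value \<open>True\<close> of \<open>b\<close> stands for even. Vertices are counted,
  not steps, because closing a walk by the edge between its ends gives a cycle of length
  \<open>card S\<close>.\<close>

definition walk_count :: "bool \<Rightarrow> nat list \<Rightarrow> nat \<Rightarrow> nat" where
  "walk_count b ls a = card {S \<in> walks ls a. even (card S) = b}"

section \<open>Combinatorics of the chords\<close>

lemma chord_bounds: "chord ls a i j \<Longrightarrow> a \<le> i \<and> i < j \<and> j \<le> a + sum_list ls"
proof (induction ls arbitrary: a)
  case (Cons L ls)
  from Cons.prems Cons.IH[of "a + L"] show ?case by auto
qed simp

lemma chord_Suc: "a \<le> i \<Longrightarrow> i < a + sum_list ls \<Longrightarrow> chord ls a i (Suc i)"
proof (induction ls arbitrary: a)
  case (Cons L ls)
  then show ?case by (cases "i < a + L") auto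
qed simp

lemma chord_noncrossing:
  "chord ls a i j \<Longrightarrow> chord ls a k l \<Longrightarrow> i < k \<Longrightarrow> k < j \<Longrightarrow> l \<le> j"
proof (induction ls arbitrary: a)
  case (Cons L ls)
  have *: "chord ls (a + L) x y \<Longrightarrow> a + L \<le> x \<and> x < y" for x y using chord_bounds by blast
  from Cons.prems Cons.IH[of "a + L"] *[of i j] *[of k l] show ?case by auto
qed simp

text \<open>A chord stays within one leg, and all mirror chords of a leg have the same centre. Hence
  what lies under a chord is again a leg.\<close>

lemma chord_nested:
  "chord ls a u w \<Longrightarrow> chord ls a i j \<Longrightarrow> u \<le> i \<Longrightarrow> j \<le> w \<Longrightarrow> j = Suc i \<or> i + j = u + w"
proof (induction ls arbitrary: a)
  case (Cons L ls)
  have *: "chord ls (a + L) x y \<Longrightarrow> a + L \<le> x \<and> x < y" for x y using chord_bounds by blast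
  from Cons.prems Cons.IH[of "a + L"] *[of i j] *[of u w] show ?case by auto
qed simp

text \<open>Each leg of length \<open>L\<close> has at most \<open>L\<close> unit steps and at most
  \<open>L\<close> mirror chords, one for each lower end.\<close>

lemma card_chords:
  "finite {(i, j). chord ls a i j} \<and> card {(i, j). chord ls a i j} \<le> 2 * sum_list ls"
proof (induction ls arbitrary: a)
  case (Cons L ls)
  let ?A = "(\<lambda>i. (i, Suc i)) ` {a..<a + L}" and ?B = "(\<lambda>i. (i, 2 * a + L - i)) ` {a..<a + L}"
  let ?C = "{(i, j). chord ls (a + L) i j}"
  have sub: "{(i, j). chord (L # ls) a i j} \<subseteq> (?A \<union> ?B) \<union> ?C" by (auto simp: image_iff)
  have fin: "finite ((?A \<union> ?B) \<union> ?C)" using Cons by auto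
  have "card ?A \<le> L" "card ?B \<le> L" using card_image_le[of "{a..<a + L}"] by fastforce+
  then have "card ((?A \<union> ?B) \<union> ?C) \<le> L + L + 2 * sum_list ls"
    using card_Un_le[of "?A \<union> ?B" ?C] card_Un_le[of ?A ?B] Cons[of "a + L"] by linarith
  then show ?case using card_mono[OF fin sub] finite_subset[OF sub fin] by auto
next
  case Nil
  have "{(i, j). chord [] a i j} = {}" by auto
  then show ?case by simp
qed

section \<open>Walks along a single leg\<close>

lemma finite_walk: "S \<in> walks ls a \<Longrightarrow> finite S"
  unfolding walks_def using finite_subset by blast

lemma finite_walks: "finite (walks ls a)"
  by (rule finite_subset[of _ "Pow {a..a + sum_list ls}"]) (auto simp: walks_def)

text \<open>The path that goes \<open>i\<close> steps along one side of the leg, crosses to the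
  mirror image and returns along the other side.\<close>

definition leg_walk :: "nat \<Rightarrow> nat \<Rightarrow> nat \<Rightarrow> nat set" where
  "leg_walk a L i = {a..a + i} \<union> {a + L - i..a + L}"

lemma leg_walk_in_walks:
  assumes "2 * i \<le> L"
  shows "leg_walk a L i \<in> walks [L] a"
proof -
  have "chord [L] a x y" if n: "next_in (leg_walk a L i) x y" for x y
  proof -
    have xy: "x \<in> leg_walk a L i" "y \<in> leg_walk a L i" "x < y"
      and gap: "\<And>k. k \<in> leg_walk a L i \<Longrightarrow> k \<le> x \<or> y \<le> k" using n by (auto simp: next_in_def)
    have b: "a \<le> x" "y \<le> a + L" using xy assms by (auto simp: leg_walk_def)
    show ?thesis
    proof (cases "Suc x \<in> leg_walk a L i")
      case True
      then show ?thesis using gap[of "Suc x"] xy b by auto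
    next
      case False
      then have "x = a + i" "Suc x < a + L - i" using xy b by (auto simp: leg_walk_def)
      moreover have "y \<le> a + L - i" using gap[of "a + L - i"] \<open>Suc x < a + L - i\<close> by (auto simp: leg_walk_def)
      moreover have "a + L - i \<le> y" using xy \<open>x = a + i\<close> by (auto simp: leg_walk_def)
      ultimately show ?thesis using xy b assms by auto
    qed
  qed
  then show ?thesis using assms by (auto simp: walks_def leg_walk_def)
qed

text \<open>A walk skipping a vertex jumps over it by a mirror chord. Two such jumps would be
  concentric and hence overlap, so there is only one.\<close>

lemma walks_leg: "walks [L] a = leg_walk a L ` {..L div 2}"
proof (intro equalityI subsetI)
  fix S assume S: "S \<in> walks [L] a"
  then have SD: "S \<subseteq> {a..a + L}" "a \<in> S" "a + L \<in> S"
    and nx: "\<And>p q. next_in S p q \<Longrightarrow> p < q \<and> (q = Suc p \<or> p + q = 2 * a + L)"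
    by (auto simp: walks_def)
  note fin = finite_walk[OF S]
  show "S \<in> leg_walk a L ` {..L div 2}"
  proof (cases "S = {a..a + L}")
    case True
    then have "S = leg_walk a L (L div 2)" by (auto simp: leg_walk_def)
    then show ?thesis by auto
  next
    case False
    then obtain x where x: "x \<notin> S" "a \<le> x" "x \<le> a + L" using SD by fastforce
    then have "a < x" "x < a + L" using SD by (metis order_le_less)+
    then obtain p q where pq: "next_in S p q" "p < x" "x < q"
      using next_in_gap[OF fin SD(2,3) _ _ x(1)] by blast
    then have sum: "p + q = 2 * a + L" using nx[of p q] by auto
    \<comment> \<open>The gap around any other missing vertex has the same centre as the first one,
      so by \<open>next_in_disjoint\<close> it is the same gap.\<close>
    have in_gap: "p < y \<and> y < q" if y: "y \<notin> S" "a \<le> y" "y \<le> a + L" for y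
    proof -
      have "a < y" "y < a + L" using SD y by (metis order_le_less)+
      then obtain p' q' where pq': "next_in S p' q'" "p' < y" "y < q'"
        using next_in_gap[OF fin SD(2,3) _ _ y(1)] by blast
      then have "p' + q' = 2 * a + L" using nx[of p' q'] by auto
      then show ?thesis
        using next_in_disjoint[OF pq(1) pq'(1)] next_in_disjoint[OF pq'(1) pq(1)] sum pq pq' nx[OF pq(1)] nx[OF pq'(1)]
        by linarith
    qed
    have pa: "a \<le> p" "q \<le> a + L" "p < q" using pq SD by (auto simp: next_in_def)
    have gap: "y \<le> p \<or> q \<le> y" if "y \<in> S" for y using pq(1) that by (auto simp: next_in_def)
    have "S = {a..p} \<union> {q..a + L}"
    proof (intro equalityI subsetI)
      fix y assume "y \<in> S" then show "y \<in> {a..p} \<union> {q..a + L}" using gap[of y] SD by auto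
    next
      fix y assume y: "y \<in> {a..p} \<union> {q..a + L}"
      show "y \<in> S"
      proof (rule ccontr)
        assume "y \<notin> S"
        then have "p < y \<and> y < q" using y pa by (intro in_gap) auto
        with y show False by auto
      qed
    qed
    moreover have "a + (p - a) = p" "a + L - (p - a) = q" "p - a \<le> L div 2" using sum pa by auto
    ultimately have "S = leg_walk a L (p - a)" by (simp add: leg_walk_def)
    with \<open>p - a \<le> L div 2\<close> show ?thesis by blast
  qed
next
  fix S assume "S \<in> leg_walk a L ` {..L div 2}"
  then show "S \<in> walks [L] a" using leg_walk_in_walks by auto
qed

text \<open>For \<open>2 * i = L\<close> the two sides share the middle vertex, which saves one. So
  the only odd case is the full tour of a leg of even length, round the final triangle.\<close>

lemma card_leg_walk:
  assumes "2 * i \<le> L"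
  shows "card (leg_walk a L i) = (if 2 * i = L then L + 1 else 2 * i + 2)"
proof (cases "2 * i = L")
  case True
  then have "leg_walk a L i = {a..a + L}" by (auto simp: leg_walk_def)
  then show ?thesis using True by simp
next
  case False
  then have "{a..a + i} \<inter> {a + L - i..a + L} = {}" using assms by auto
  then have "card (leg_walk a L i) = card {a..a + i} + card {a + L - i..a + L}"
    unfolding leg_walk_def by (intro card_Un_disjoint) auto
  also have "\<dots> = 2 * i + 2" using assms by (simp add: Suc_diff_le)
  finally show ?thesis using False by simp
qed

lemma inj_leg_walk: "inj_on (leg_walk a L) {..L div 2}"
proof (rule linorder_inj_onI')
  fix i j assume "i \<in> {..L div 2}" "j \<in> {..L div 2}" "i < j"
  then have "a + j \<in> leg_walk a L j" "a + j \<notin> leg_walk a L i" by (auto simp: leg_walk_def)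
  then show "leg_walk a L i \<noteq> leg_walk a L j" by auto
qed

lemma walk_count_leg:
  "walk_count True [L] a = (L + 1) div 2" "walk_count False [L] a = (if even L then 1 else 0)"
proof -
  have *: "walk_count b [L] a = card {i \<in> {..L div 2}. even (card (leg_walk a L i)) = b}" for b
  proof -
    have "{S \<in> walks [L] a. even (card S) = b} = leg_walk a L ` {i \<in> {..L div 2}. even (card (leg_walk a L i)) = b}"
      by (auto simp: walks_leg)
    moreover have "inj_on (leg_walk a L) {i \<in> {..L div 2}. even (card (leg_walk a L i)) = b}"
      by (rule inj_on_subset[OF inj_leg_walk]) auto
    ultimately show ?thesis by (simp add: walk_count_def card_image)
  qed
  have "{i \<in> {..L div 2}. even (card (leg_walk a L i)) = True} = {..<(L + 1) div 2}"
    by (auto simp: card_leg_walk split: if_splits)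
  then show "walk_count True [L] a = (L + 1) div 2" by (simp add: *)
  have "{i \<in> {..L div 2}. even (card (leg_walk a L i)) = False} = (if even L then {L div 2} else {})"
    by (auto simp: card_leg_walk split: if_splits)
  then show "walk_count False [L] a = (if even L then 1 else 0)" by (simp add: *)
qed

section \<open>Splitting walks where legs meet\<close>

lemma walk_meets_cut:
  assumes "S \<in> walks (L # ls) a"
  shows "a + L \<in> S"
proof (rule ccontr)
  assume no: "a + L \<notin> S"
  have S: "a \<in> S" "a + (L + sum_list ls) \<in> S" "\<And>i j. next_in S i j \<Longrightarrow> chord (L # ls) a i j"
    using assms by (auto simp: walks_def)
  have "L \<noteq> 0" "sum_list ls \<noteq> 0" using no S by (metis add.right_neutral)+
  then have "a < a + L" "a + L < a + (L + sum_list ls)" by linarith+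
  then obtain p q where pq: "next_in S p q" "p < a + L" "a + L < q"
    using next_in_gap[OF finite_walk[OF assms] S(1,2) _ _ no] by blast
  \<comment> \<open>The first leg has no chord ending beyond the cut, the later legs none starting
    before it.\<close>
  then show False using S(3)[OF pq(1)] chord_bounds[of ls "a + L" p q] by auto
qed

text \<open>Every walk passes the common end of the first two parts, so restriction to either side
  of it inverts the union.\<close>

lemma bij_betw_walks_Cons:
  "bij_betw (\<lambda>(A, B). A \<union> B) (walks [L] a \<times> walks ls (a + L)) (walks (L # ls) a)"
proof -
  let ?c = "a + L" and ?g = "\<lambda>S. (S \<inter> {..a + L}, S \<inter> {a + L..})"
  have split: "(A \<union> B) \<inter> {..?c} = A" "(A \<union> B) \<inter> {?c..} = B" "A \<union> B \<in> walks (L # ls) a"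
    if AB: "A \<in> walks [L] a" "B \<in> walks ls ?c" for A B
  proof -
    have A: "A \<subseteq> {a..?c}" "a \<in> A" "?c \<in> A" "\<And>i j. next_in A i j \<Longrightarrow> chord [L] a i j"
      using AB by (auto simp: walks_def)
    have B: "B \<subseteq> {?c..?c + sum_list ls}" "?c \<in> B" "?c + sum_list ls \<in> B" "\<And>i j. next_in B i j \<Longrightarrow> chord ls ?c i j"
      using AB by (auto simp: walks_def)
    show "(A \<union> B) \<inter> {..?c} = A" "(A \<union> B) \<inter> {?c..} = B"
      using A(1,3) B(1,2) by (fastforce simp: subset_iff dest: le_antisym)+
    have "chord (L # ls) a i j" if n: "next_in (A \<union> B) i j" for i j
    proof -
      have D: "i \<in> A \<union> B" "j \<in> A \<union> B" "i < j" "\<And>k. k \<in> A \<union> B \<Longrightarrow> k \<le> i \<or> j \<le> k"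
        using n by (auto simp: next_in_def)
      have AB': "x \<in> A \<Longrightarrow> x \<le> ?c" "x \<in> B \<Longrightarrow> ?c \<le> x" for x using A(1) B(1) by auto
      \<comment> \<open>The cut vertex belongs to both parts, so no pair of neighbours straddles
        it.\<close>
      have "next_in A i j \<or> next_in B i j"
      proof (cases "j \<le> ?c")
        case True
        then have "i \<in> A" using D AB'(2)[of i] by auto
        moreover have "j \<in> A" using D(2) True A(3) AB'(2)[of j] by (cases "j = ?c") auto
        ultimately show ?thesis using D by (auto simp: next_in_def)
      next
        case False
        then have "j \<in> B" "?c \<le> i" using D AB'(1)[of j] A(3) by auto
        moreover have "i \<in> B" using D(1) \<open>?c \<le> i\<close> B(2) AB'(1)[of i] by (cases "i = ?c") auto
        ultimately show ?thesis using D by (auto simp: next_in_def)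
      qed
      then show ?thesis using A(4)[of i j] B(4)[of i j] by auto
    qed
    moreover have "x \<in> {a..a + (L + sum_list ls)}" if "x \<in> A \<union> B" for x
      using that subsetD[OF A(1), of x] subsetD[OF B(1), of x] by auto
    ultimately show "A \<union> B \<in> walks (L # ls) a"
      using A(2) B(3) unfolding walks_def by (simp add: subset_iff add.assoc del: chord.simps)
  qed
  have restrict: "S \<inter> {..?c} \<in> walks [L] a" "S \<inter> {?c..} \<in> walks ls ?c" if S: "S \<in> walks (L # ls) a" for S
  proof -
    have c: "?c \<in> S" by (rule walk_meets_cut[OF S])
    have SD: "S \<subseteq> {a..a + (L + sum_list ls)}" "a \<in> S" "a + (L + sum_list ls) \<in> S" "\<And>i j. next_in S i j \<Longrightarrow> chord (L # ls) a i j"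
      using S by (auto simp: walks_def)
    have "chord [L] a i j" if "next_in (S \<inter> {..?c}) i j" for i j
    proof -
      have "next_in S i j" "j \<le> ?c" using that c by (auto simp: next_in_def)
      then show ?thesis using SD(4)[of i j] chord_bounds[of ls ?c i j] by auto
    qed
    then show "S \<inter> {..?c} \<in> walks [L] a" using SD c by (auto simp: walks_def)
    have "chord ls ?c i j" if "next_in (S \<inter> {?c..}) i j" for i j
    proof -
      have "next_in S i j" "?c \<le> i" using that c by (auto simp: next_in_def)
      then show ?thesis using SD(4)[of i j] by (auto simp: next_in_def)
    qed
    then show "S \<inter> {?c..} \<in> walks ls ?c" using SD c by (auto simp: walks_def add.assoc)
  qed
  show ?thesis
  proof (rule bij_betw_byWitness[where f' = ?g])
    show "\<forall>x\<in>walks [L] a \<times> walks ls ?c. ?g (case x of (A, B) \<Rightarrow> A \<union> B) = x"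
      using split(1,2) by auto
    show "\<forall>S\<in>walks (L # ls) a. (case ?g S of (A, B) \<Rightarrow> A \<union> B) = S" by auto
    show "(\<lambda>(A, B). A \<union> B) ` (walks [L] a \<times> walks ls ?c) \<subseteq> walks (L # ls) a" using split(3) by auto
    show "?g ` walks (L # ls) a \<subseteq> walks [L] a \<times> walks ls ?c" using restrict by auto
  qed
qed

lemma card_walk_Un:
  assumes "A \<in> walks [L] a" "B \<in> walks ls (a + L)"
  shows "Suc (card (A \<union> B)) = card A + card B"
proof -
  have "A \<subseteq> {..a + L}" "a + L \<in> A" "B \<subseteq> {a + L..}" "a + L \<in> B"
    using assms by (auto simp: walks_def)
  then have "A \<inter> B = {a + L}" using order.antisym by blast
  then show ?thesis using card_Un_Int[of A B] finite_walk assms by auto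
qed

text \<open>The shared cut vertex is counted once, so the union is even exactly when one of the two
  parts is even and the other odd.\<close>

lemma walk_count_Cons:
  "walk_count b (L # ls) a = walk_count True [L] a * walk_count (\<not> b) ls (a + L)
     + walk_count False [L] a * walk_count b ls (a + L)"
proof -
  let ?W = "\<lambda>b ls a. {S \<in> walks ls a. even (card S) = b}"
  let ?f = "\<lambda>(A, B). A \<union> B :: nat set"
  let ?X = "?W True [L] a \<times> ?W (\<not> b) ls (a + L)" and ?Y = "?W False [L] a \<times> ?W b ls (a + L)"
  have par: "even (card (A \<union> B)) \<longleftrightarrow> even (card A) \<noteq> even (card B)"
    if "A \<in> walks [L] a" "B \<in> walks ls (a + L)" for A B
    using card_walk_Un[OF that] by (metis even_Suc even_add)
  have inj: "inj_on ?f (walks [L] a \<times> walks ls (a + L))"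
    and im: "?f ` (walks [L] a \<times> walks ls (a + L)) = walks (L # ls) a"
    using bij_betw_walks_Cons unfolding bij_betw_def by blast+
  have "?W b (L # ls) a = ?f ` {x \<in> walks [L] a \<times> walks ls (a + L). even (card (?f x)) = b}"
    unfolding im[symmetric] by blast
  also have "{x \<in> walks [L] a \<times> walks ls (a + L). even (card (?f x)) = b} = ?X \<union> ?Y"
    using par by auto
  finally have "card (?W b (L # ls) a) = card (?X \<union> ?Y)"
    using inj_on_subset[OF inj, of "?X \<union> ?Y"] by (auto intro!: card_image)
  also have "\<dots> = card ?X + card ?Y"
    using finite_walks by (intro card_Un_disjoint) auto
  finally show ?thesis by (simp add: walk_count_def card_cartesian_product)
qed

section \<open>Closing up the legs to an outer polygon\<close>

definition closed_chord :: "nat list \<Rightarrow> nat \<Rightarrow> nat \<Rightarrow> bool" where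
  "closed_chord ls i j \<longleftrightarrow> chord ls 0 i j \<or> i = 0 \<and> j = sum_list ls"

lemma outer_polygon_chord:
  assumes "2 \<le> sum_list ls"
  shows "outer_polygon (sum_list ls) (closed_chord ls)"
proof
  fix i j k l
  assume "closed_chord ls i j" "closed_chord ls k l" "i < k" "k < j"
  then show "l \<le> j" using chord_noncrossing[of ls 0 i j k l] chord_bounds[of ls 0] by (force simp: closed_chord_def)
qed (use assms chord_bounds[of ls 0] chord_Suc[of 0 _ ls] in \<open>force simp: closed_chord_def\<close>)+

text \<open>Positive lengths make the first cut a third vertex besides the two ends, so closing a
  walk gives a genuine cycle.\<close>

lemma walks_subset_cycle_verts:
  assumes "0 < L" "0 < sum_list ls"
  shows "walks (L # ls) 0 \<subseteq> outer_polygon.cycle_verts (sum_list (L # ls)) (closed_chord (L # ls))"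
proof
  interpret outer_polygon "sum_list (L # ls)" "closed_chord (L # ls)"
    using assms by (intro outer_polygon_chord) auto
  fix S assume S: "S \<in> walks (L # ls) 0"
  have fin: "finite S" by (rule finite_walk[OF S])
  have SD: "S \<subseteq> {..L + sum_list ls}" "0 \<in> S" "L + sum_list ls \<in> S" "L \<in> S"
    "\<And>i j. next_in S i j \<Longrightarrow> chord (L # ls) 0 i j"
    using S walk_meets_cut[OF S] by (auto simp: walks_def)
  have "card {0, L, L + sum_list ls} \<le> card S" using SD fin by (intro card_mono) auto
  moreover have "distinct [0, L, L + sum_list ls]" using assms by (simp del: sum_list_eq_0_iff)
  then have "card {0, L, L + sum_list ls} = 3" using distinct_card by fastforce
  ultimately have "3 \<le> card S" by simp
  moreover have "Min S = 0" "Max S = L + sum_list ls"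
    using SD fin by (auto intro!: Min_eqI Max_eqI)
  ultimately show "S \<in> cycle_verts" using SD unfolding cycle_verts_def closed_chord_def by auto
qed

text \<open>A cycle that avoids the edge joining the two ends lies under a single chord, and the part of a leg
  under a chord is again a leg.\<close>

lemma cycle_verts_subset:
  assumes "2 \<le> sum_list ls"
  shows "outer_polygon.cycle_verts (sum_list ls) (closed_chord ls)
     \<subseteq> walks ls 0 \<union> (\<Union>(u, w)\<in>{(u, w). chord ls 0 u w}. walks [w - u] u)"
proof
  interpret outer_polygon "sum_list ls" "closed_chord ls"
    using assms by (intro outer_polygon_chord) auto
  fix S assume "S \<in> cycle_verts"
  then have S: "S \<subseteq> {..sum_list ls}" "3 \<le> card S" "closed_chord ls (Min S) (Max S)"
    "\<And>i j. next_in S i j \<Longrightarrow> closed_chord ls i j"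
    by (auto simp: cycle_verts_def)
  have fin: "finite S" "S \<noteq> {}" using S(1,2) finite_subset[of S "{..sum_list ls}"] by auto
  have bd: "Min S \<in> S" "Max S \<in> S" "S \<subseteq> {Min S..Max S}" using fin by auto
  \<comment> \<open>If the edge between 0 and the last vertex joined neighbours in \<open>S\<close>,
    no vertex would fit between them and \<open>S\<close> would have at most two elements.\<close>
  have nx: "chord ls 0 i j" if n: "next_in S i j" for i j
  proof -
    have "\<not> (i = 0 \<and> j = sum_list ls)"
    proof
      assume "i = 0 \<and> j = sum_list ls"
      then have "S \<subseteq> {0, sum_list ls}" using n S(1) by (force simp: next_in_def)
      then have "card S \<le> card {0, sum_list ls}" by (intro card_mono) auto
      also have "\<dots> \<le> 2" by (simp add: card_insert_if)
      finally show False using S(2) by simp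
    qed
    then show ?thesis using S(4)[OF n] by (auto simp: closed_chord_def)
  qed
  show "S \<in> walks ls 0 \<union> (\<Union>(u, w)\<in>{(u, w). chord ls 0 u w}. walks [w - u] u)"
  proof (cases "chord ls 0 (Min S) (Max S)")
    case True
    then have lt: "Min S < Max S" using chord_bounds by blast
    have "chord [Max S - Min S] (Min S) i j" if n: "next_in S i j" for i j
    proof -
      have ij: "Min S \<le> i" "i < j" "j \<le> Max S" using n bd fin by (auto simp: next_in_def)
      then show ?thesis using chord_nested[OF True nx[OF n]] by auto
    qed
    then have "S \<in> walks [Max S - Min S] (Min S)" using bd lt by (auto simp: walks_def)
    then show ?thesis using True by blast
  next
    case False
    then have "Min S = 0" "Max S = sum_list ls" using S(3) by (auto simp: closed_chord_def)
    then have "S \<in> walks ls 0" using S(1) bd nx by (auto simp: walks_def)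
    then show ?thesis by blast
  qed
qed

text \<open>Cycles that are not walks through all legs lie under one of at most \<open>2 * n\<close>
  chords, with at most \<open>n + 1\<close> leg walks each. Parity is ignored in this quadratic
  error term.\<close>

lemma cycle_count_bounds:
  fixes b :: bool
  assumes "0 < L" "0 < sum_list ls"
  defines "n \<equiv> sum_list (L # ls)"
  defines "c \<equiv> card {C \<in> cycles (outer_polygon.graph n (closed_chord (L # ls))). even (cycle_length C) = b}"
  shows "walk_count b (L # ls) 0 \<le> c" "c \<le> walk_count b (L # ls) 0 + 2 * n * (n + 1)"
proof -
  interpret outer_polygon n "closed_chord (L # ls)"
    unfolding n_def using assms by (intro outer_polygon_chord) auto
  have c: "c = card {S \<in> cycle_verts. even (card S) = b}"
    unfolding c_def by (rule card_cycles_parity)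
  let ?W = "{S \<in> walks (L # ls) 0. even (card S) = b}"
  let ?I = "{(u, w). chord (L # ls) 0 u w}"
  let ?U = "\<Union>(u, w)\<in>?I. walks [w - u] u"
  have "finite cycle_verts" by (rule finite_subset[of _ "Pow {..n}"]) (auto simp: cycle_verts_def)
  then show "walk_count b (L # ls) 0 \<le> c"
    unfolding c walk_count_def using walks_subset_cycle_verts[OF assms(1,2)]
    by (intro card_mono) (auto simp: n_def)
  have "2 \<le> n" by (rule n_ge_2)
  have finI: "finite ?I" "card ?I \<le> 2 * n" using card_chords[of "L # ls" 0] by (auto simp: n_def)
  have leg: "card (walks [w - u] u) \<le> n + 1" if "chord (L # ls) 0 u w" for u w
  proof -
    have "card (walks [w - u] u) \<le> card {..(w - u) div 2}" unfolding walks_leg by (intro card_image_le) simp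
    also have "\<dots> \<le> n + 1" using chord_bounds[OF that] div_le_dividend[of "w - u" 2] unfolding n_def card_atMost
      by linarith
    finally show ?thesis .
  qed
  have "card ?U \<le> (\<Sum>(u, w)\<in>?I. card (walks [w - u] u))"
    using card_UN_le[OF finI(1), of "\<lambda>(u, w). walks [w - u] u"] by (simp add: case_prod_beta)
  also have "\<dots> \<le> card ?I * (n + 1)"
    by (rule order_trans[OF sum_bounded_above[where K = "n + 1"]]) (use leg in \<open>auto simp del: chord.simps\<close>)
  also have "\<dots> \<le> 2 * n * (n + 1)" using finI(2) by (intro mult_right_mono) auto
  finally have U: "card ?U \<le> 2 * n * (n + 1)" .
  have "c \<le> card (?W \<union> ?U)"
    unfolding c using cycle_verts_subset[of "L # ls"] \<open>2 \<le> n\<close> finI(1) finite_walks unfolding n_def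
    by (intro card_mono) (auto split: prod.splits)
  also have "\<dots> \<le> card ?W + card ?U" by (rule card_Un_le)
  finally show "c \<le> walk_count b (L # ls) 0 + 2 * n * (n + 1)" using U by (simp add: walk_count_def)
qed

section \<open>Spiders\<close>

text \<open>The flag t makes the last face of the third leg a quadrangle instead of a triangle; the flag f adds
  one edge to the central face, whose length is thus 4 or 5.\<close>

definition spider_legs :: "bool \<Rightarrow> bool \<Rightarrow> nat \<Rightarrow> nat list" where
  "spider_legs t f m = [2 * m + 2, 2 * m + 2, 2 * m + 2 + of_bool t] @ (if f then [1] else [])"

definition spider :: "bool \<Rightarrow> bool \<Rightarrow> nat \<Rightarrow> nat ugraph" where
  "spider t f m = outer_polygon.graph (sum_list (spider_legs t f m)) (closed_chord (spider_legs t f m))"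

lemma sum_spider_legs: "sum_list (spider_legs t f m) = 6 * m + 6 + of_bool t + of_bool f"
  by (simp add: spider_legs_def)

lemma walk_count_spider:
  "(m + 1) ^ 3 \<le> walk_count (\<not> f) (spider_legs t f m) a"
  "0 < walk_count f (spider_legs t f m) a"
  "walk_count f (spider_legs t f m) a \<le> 6 * (m + 1)\<^sup>2"
proof -
  \<comment> \<open>Restricted to at least two legs: the recursion reproduces single-leg counts on
    its right side, and those are evaluated by \<open>walk_count_leg\<close>.\<close>
  have wc: "walk_count True (L # K # ls) a = walk_count True [L] a * walk_count False (K # ls) (a + L)
     + walk_count False [L] a * walk_count True (K # ls) (a + L)"
    "walk_count False (L # K # ls) a = walk_count True [L] a * walk_count True (K # ls) (a + L)
     + walk_count False [L] a * walk_count False (K # ls) (a + L)" for L K ls a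
    using walk_count_Cons[of _ L "K # ls" a] by simp_all
  \<comment> \<open>The first two legs have \<open>m + 1\<close> even walks and one odd walk each,
    the third \<open>m + 1 + of_bool t\<close> and \<open>1 - of_bool t\<close>. The factor
    \<open>(m + 1)\<^sup>2 + 1\<close> counts equal parities on the first two legs,
    \<open>2 * (m + 1)\<close> different ones; an extra leg of length 1 flips the total
    parity.\<close>
  have eq: "walk_count (\<not> f) (spider_legs t f m) a
      = ((m + 1)\<^sup>2 + 1) * (m + 1 + of_bool t) + 2 * (m + 1) * (1 - of_bool t)"
    "walk_count f (spider_legs t f m) a
      = ((m + 1)\<^sup>2 + 1) * (1 - of_bool t) + 2 * (m + 1) * (m + 1 + of_bool t)"
    by (cases f; cases t; simp add: spider_legs_def wc walk_count_leg algebra_simps power2_eq_square)+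
  show "(m + 1) ^ 3 \<le> walk_count (\<not> f) (spider_legs t f m) a"
    "0 < walk_count f (spider_legs t f m) a"
    "walk_count f (spider_legs t f m) a \<le> 6 * (m + 1)\<^sup>2"
    unfolding eq by (cases t; simp add: algebra_simps power2_eq_square power3_eq_cube)+
qed

lemma cycle_count_spider:
  fixes t f :: bool and m :: nat
  defines "c \<equiv> \<lambda>b. card {C \<in> cycles (spider t f m). even (cycle_length C) = b}"
  shows "(m + 1) ^ 3 \<le> c (\<not> f)" "0 < c f" "c f \<le> 150 * (m + 1)\<^sup>2"
proof -
  define n where "n = sum_list (spider_legs t f m)"
  obtain L ls where legs: "spider_legs t f m = L # ls" "0 < L" "0 < sum_list ls"
    by (auto simp: spider_legs_def)
  note bounds = cycle_count_bounds[OF legs(2,3), folded legs(1), folded spider_def c_def n_def]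
  show "(m + 1) ^ 3 \<le> c (\<not> f)" "0 < c f"
    using bounds(1)[of "\<not> f"] bounds(1)[of f] walk_count_spider[where f = f and t = t and m = m and a = 0] unfolding c_def by linarith+
  \<comment> \<open>The constant 150 is 6 from the walks plus twice 72 from the error term.\<close>
  have "n \<le> 8 * (m + 1)" "n + 1 \<le> 9 * (m + 1)" unfolding n_def sum_spider_legs by auto
  then have "n * (n + 1) \<le> (8 * (m + 1)) * (9 * (m + 1))" by (intro mult_mono) auto
  also have "\<dots> = 72 * (m + 1)\<^sup>2" by (simp add: power2_eq_square algebra_simps)
  finally have "n * (n + 1) \<le> 72 * (m + 1)\<^sup>2" .
  moreover have "c f \<le> walk_count f (spider_legs t f m) 0 + 2 * (n * (n + 1))"
    using bounds(2)[of f] unfolding c_def mult.assoc .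
  ultimately show "c f \<le> 150 * (m + 1)\<^sup>2"
    using walk_count_spider(3)[where f = f and t = t and m = m and a = 0] by linarith
qed

text \<open>A cubic lower bound is divided by a quadratic upper bound. Positivity of the denominator
  matters, as division by zero would give 0.\<close>

lemma ratio_spider:
  "real (m + 1) / 150 \<le> real (card {C \<in> cycles (spider t f m). even (cycle_length C) = (\<not> f)})
     / real (card {C \<in> cycles (spider t f m). even (cycle_length C) = f})"
    (is "_ \<le> real ?M / real ?N")
proof -
  note count = cycle_count_spider[where t = t and f = f and m = m]
  have N: "0 < ?N" "real ?N \<le> 150 * (real (m + 1))\<^sup>2" and M: "(real (m + 1)) ^ 3 \<le> real ?M"
    using count(2) of_nat_mono[OF count(3), where ?'a = real] of_nat_mono[OF count(1), where ?'a = real]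
    by (simp_all only: of_nat_mult of_nat_power of_nat_numeral)
  have "real (m + 1) / 150 * real ?N \<le> real (m + 1) / 150 * (150 * (real (m + 1))\<^sup>2)"
    using N(2) by (intro mult_left_mono) auto
  also have "\<dots> = (real (m + 1)) ^ 3" by (simp add: power2_eq_square power3_eq_cube)
  also note M
  finally show ?thesis using N(1) by (simp add: pos_le_divide_eq)
qed

theorem theorem2p4:
  fixes p :: "nat \<Rightarrow> bool" and r :: "nat ugraph \<Rightarrow> real"
  assumes "p \<in> {odd, even}"
    and "r \<in> {\<lambda>G. real (c_odd G) / real (c_even G), \<lambda>G. real (c_even G) / real (c_odd G)}"
  shows "\<exists>(G :: nat \<Rightarrow> nat ugraph) (pos :: nat \<Rightarrow> nat \<Rightarrow> complex)
            (crv :: nat \<Rightarrow> nat set \<Rightarrow> real \<Rightarrow> complex).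
    (\<forall>n. finite_simple_graph (G n) \<and> k_connected 2 (G n) \<and>
         outerplanar_embedding (G n) (pos n) (crv n) \<and>
         outer_boundary (G n) (pos n) (crv n) \<in> cycles (G n) \<and>
         p (cycle_length (outer_boundary (G n) (pos n) (crv n)))) \<and>
    filterlim (\<lambda>n. card (verts (G n))) at_top sequentially \<and>
    filterlim (\<lambda>n. r (G n)) at_top sequentially"
proof -
  \<comment> \<open>The ratio fixes the central face: length 5 (\<open>f\<close> true) lets odd
    cycles prevail, length 4 even ones.\<close>
  obtain f where f: "\<And>G. r G = real (card {C \<in> cycles G. even (cycle_length C) = (\<not> f)})
     / real (card {C \<in> cycles G. even (cycle_length C) = f})"
  proof -
    from assms(2) consider "r = (\<lambda>G. real (c_odd G) / real (c_even G))"
      | "r = (\<lambda>G. real (c_even G) / real (c_odd G))" by blast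
    then show ?thesis
    proof cases
      case 1
      then show ?thesis by (intro that[of True]) (simp add: c_odd_def c_even_def)
    next
      case 2
      then show ?thesis by (intro that[of False]) (simp add: c_odd_def c_even_def)
    qed
  qed
  \<comment> \<open>The boundary has length \<open>6 * m + 7 + of_bool t + of_bool f\<close>, odd
    exactly when \<open>t\<close> and \<open>f\<close> agree, so \<open>t\<close> adjusts its parity
    after \<open>f\<close> is fixed.\<close>
  obtain t where t: "\<And>m. p (Suc (sum_list (spider_legs t f m)))"
  proof -
    from assms(1) consider "p = odd" | "p = even" by blast
    then show ?thesis
    proof cases
      case 1
      then show ?thesis by (intro that[of f]) (simp add: sum_spider_legs)
    next
      case 2
      then show ?thesis by (intro that[of "\<not> f"]) (simp add: sum_spider_legs)
    qed
  qed
  have op: "outer_polygon (sum_list (spider_legs t f m)) (closed_chord (spider_legs t f m))" for m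
    by (rule outer_polygon_chord) (simp add: sum_spider_legs)
  have "m \<le> card (verts (spider t f m))" for m
    unfolding spider_def outer_polygon.verts_graph[OF op] by (simp add: sum_spider_legs)
  then have "filterlim (\<lambda>m. card (verts (spider t f m))) at_top sequentially"
    by (intro filterlim_at_top_mono[OF filterlim_ident]) auto
  moreover have "filterlim (\<lambda>m. r (spider t f m)) at_top sequentially"
  proof (rule filterlim_at_top_mono)
    show "filterlim (\<lambda>m. real (m + 1) / 150) at_top sequentially" by real_asymp
    show "eventually (\<lambda>m. real (m + 1) / 150 \<le> r (spider t f m)) sequentially"
      unfolding f by (intro always_eventually allI ratio_spider)
  qed
  ultimately show ?thesis
    using outer_polygon.finite_simple_graph[OF op] outer_polygon.two_connected[OF op]
      outer_polygon.outerplanar[OF op] outer_polygon.outer_boundary_cycle[OF op] t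
    by (intro exI[of _ "spider t f"] exI[of _ "\<lambda>_. parabola"] exI[of _ "\<lambda>_. segment_path"])
      (auto simp: spider_def)
qed

end
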